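(* Let $\Sigma_\bullet$ be the explicit higher $\lambda$-conversion tower and let $\mathscr{R}_\bullet(\mathscr{G}_\lambda)$ be the recursive completion of the reflexive $6$-cell extension of the low-dimensional $\lambda$-coherence core $\mathscr{G}_\lambda$ (both as described in the context). Then: (i) for every $n\in\mathbb{N}$ there is a map $\mathrm{realize}_n:\mathscr{R}_n(\mathscr{G}_\lambda)\to\Sigma_n$; (ii) these maps commute strictly with source and target: for every $(n+1)$-cell $x$ of $\mathscr{R}_\bullet(\mathscr{G}_\lambda)$, $s(\mathrm{realize}_{n+1}(x))=\mathrm{realize}_n(s x)$ and $t(\mathrm{realize}_{n+1}(x))=\mathrm{realize}_n(t x)$; (iii) hence $\Sigma_\bullet$ carries a strict boundary-preserving realization of $\mathscr{R}_\bullet(\mathscr{G}_\lambda)$ extending the low-dimensional core (i.e. $\mathrm{realize}_n$ is the identity identification for $n\le 3$).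
   Context: Untyped $\lambda$-terms are written with de Bruijn indices: $M,N::=\mathtt{var}\,n\mid M\,N\mid \lambda M$. A reduction sequence from $M$ to $N$ is a finite zigzag $M=M_0\leftrightarrow M_1\leftrightarrow\cdots\leftrightarrow M_k=N$ of $\beta$-steps, $\eta$-steps and their formal inverses; $\mathrm{RedSeq}(M,N)$ is the type of these. $\mathrm{Homotopy}_2(p,q)$ ($p,q\in\mathrm{RedSeq}(M,N)$) is the inductive type of explicit 2-cells generated by reflexivity, symmetry, transitivity, left/right whiskering, horizontal composition, associators and unitors; $\mathrm{Homotopy}_3(\alpha,\beta)$ (for parallel 2-cells) is the analogous inductive type of explicit 3-cells, including pentagon, triangle and interchange generators. For a type $X$ and $x,y\in X$, $\mathrm{HigherDeriv}_X(x,y)$ is the inductive type generated by $\mathsf{refl}_x:\mathrm{HigherDeriv}_X(x,x)$, $\mathsf{symm}:\mathrm{HigherDeriv}_X(x,y)\to\mathrm{HigherDeriv}_X(y,x)$ and $\mathsf{trans}:\mathrm{HigherDeriv}_X(x,y)\to\mathrm{HigherDeriv}_X(y,z)\to\mathrm{HigherDeriv}_X(x,z)$; for a map $f:X\to Y$, $\mathrm{HigherDeriv}(f):\mathrm{HigherDeriv}_X(x,y)\to\mathrm{HigherDeriv}_Y(f x,f y)$ is defined by recursion on constructors. The explicit tower $\Sigma_\bullet$ is the globular set with $\Sigma_0=$ terms, $\Sigma_1=$ reduction sequences, $\Sigma_2=$ explicit 2-cells, $\Sigma_3=$ explicit 3-cells (each packed with its source and target), and for $n\ge 4$ an $n$-cell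 is a triple $(x,y,h)$ with $x,y$ parallel $(n-1)$-cells and $h\in\mathrm{HigherDeriv}(x,y)$, with source $x$ and target $y$. The low-dimensional core $\mathscr{G}_\lambda$ has objects terms, 1-cells $\mathrm{RedSeq}$, 2-cells $\mathrm{Homotopy}_2$, 3-cells $\mathrm{Homotopy}_3$; its reflexive $6$-cell extension adds, in dimensions $4,5,6$, cells $\mathrm{HigherDeriv}(\eta,\theta)$ between parallel cells of the previous dimension (no other generators). The recursive completion $\mathscr{R}_\bullet(\mathscr{G}_\lambda)$ keeps dimensions $0$–$6$ of this extension, and for $n\ge 6$ an $(n+1)$-cell is a triple $(x,y,h)$ with $x,y\in\mathscr{R}_n$ and $h\in\mathrm{HigherDeriv}(x,y)$, with source $x$ and target $y$. *)

theory Defs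
  imports "HOL-Library.FuncSet"
begin

section \<open>Untyped terms and reduction sequences\<close>

datatype trm = Var nat | App trm trm | Lam trm

primrec lift :: "trm \<Rightarrow> nat \<Rightarrow> trm" where
  "lift (Var i) k = (if i < k then Var i else Var (Suc i))"
| "lift (App M N) k = App (lift M k) (lift N k)"
| "lift (Lam M) k = Lam (lift M (Suc k))"

primrec subst :: "trm \<Rightarrow> trm \<Rightarrow> nat \<Rightarrow> trm" where
  "subst (Var i) N k = (if k < i then Var (i - 1) else if i = k then N else Var i)"
| "subst (App M M') N k = App (subst M N k) (subst M' N k)"
| "subst (Lam M) N k = Lam (subst M (lift N 0) (Suc k))"

text \<open>A one-step reduction is recorded together with the redex it contracts: it is a contraction
  \<open>Beta M N\<close> of \<open>(\<lambda>M) N\<close> or \<open>Eta M\<close> of \<open>\<lambda>(M\<up> 0)\<close>, placed in a term context. So two different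
  redexes of a term give different steps even if the contracta coincide.\<close>

datatype step =
    Beta trm trm
  | Eta trm
  | AppL step trm
  | AppR trm step
  | Xi step

primrec step_src :: "step \<Rightarrow> trm" where
  "step_src (Beta M N) = App (Lam M) N"
| "step_src (Eta M) = Lam (App (lift M 0) (Var 0))"
| "step_src (AppL s N) = App (step_src s) N"
| "step_src (AppR M s) = App M (step_src s)"
| "step_src (Xi s) = Lam (step_src s)"

primrec step_tgt :: "step \<Rightarrow> trm" where
  "step_tgt (Beta M N) = subst M N 0"
| "step_tgt (Eta M) = M"
| "step_tgt (AppL s N) = App (step_tgt s) N"
| "step_tgt (AppR M s) = App M (step_tgt s)"
| "step_tgt (Xi s) = Lam (step_tgt s)"

text \<open>The dependent families of the theory are rendered as a datatype of raw cells, whose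
  constructors are the generators, and an inductive predicate assigning boundaries. A raw cell has
  at most one boundary, so the members of a family are exactly the raw cells with that boundary.\<close>

datatype redseq =
    Empty trm
  | Step step redseq
  | InvStep step redseq

inductive is_redseq :: "trm \<Rightarrow> trm \<Rightarrow> redseq \<Rightarrow> bool" where
  Empty: "is_redseq M M (Empty M)"
| Step: "is_redseq (step_tgt s) N p \<Longrightarrow> is_redseq (step_src s) N (Step s p)"
| InvStep: "is_redseq (step_src s) N p \<Longrightarrow> is_redseq (step_tgt s) N (InvStep s p)"

definition RedSeq :: "trm \<Rightarrow> trm \<Rightarrow> redseq set" where
  "RedSeq M N = {p. is_redseq M N p}"

primrec concat_seq :: "redseq \<Rightarrow> redseq \<Rightarrow> redseq" (infixr \<open>\<bullet>\<close> 70) where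
  "Empty M \<bullet> q = q"
| "Step s p \<bullet> q = Step s (p \<bullet> q)"
| "InvStep s p \<bullet> q = InvStep s (p \<bullet> q)"


section \<open>Explicit 2-cells and 3-cells\<close>

datatype cell2 =
    Refl2 redseq
  | Symm2 cell2
  | Trans2 cell2 cell2
  | WhiskerL2 redseq cell2
  | WhiskerR2 cell2 redseq
  | HComp2 cell2 cell2
  | Assoc2 redseq redseq redseq
  | LeftUnitor2 redseq
  | RightUnitor2 redseq

inductive is_homotopy2 :: "trm \<Rightarrow> trm \<Rightarrow> redseq \<Rightarrow> redseq \<Rightarrow> cell2 \<Rightarrow> bool" where
  Refl2: "p \<in> RedSeq M N \<Longrightarrow> is_homotopy2 M N p p (Refl2 p)"
| Symm2: "is_homotopy2 M N p q \<alpha> \<Longrightarrow> is_homotopy2 M N q p (Symm2 \<alpha>)"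
| Trans2: "is_homotopy2 M N p q \<alpha> \<Longrightarrow> is_homotopy2 M N q r \<beta> \<Longrightarrow>
    is_homotopy2 M N p r (Trans2 \<alpha> \<beta>)"
| WhiskerL2: "r \<in> RedSeq L M \<Longrightarrow> is_homotopy2 M N p q \<alpha> \<Longrightarrow>
    is_homotopy2 L N (r \<bullet> p) (r \<bullet> q) (WhiskerL2 r \<alpha>)"
| WhiskerR2: "is_homotopy2 L M p q \<alpha> \<Longrightarrow> r \<in> RedSeq M N \<Longrightarrow>
    is_homotopy2 L N (p \<bullet> r) (q \<bullet> r) (WhiskerR2 \<alpha> r)"
| HComp2: "is_homotopy2 L M p p' \<alpha> \<Longrightarrow> is_homotopy2 M N q q' \<beta> \<Longrightarrow>
    is_homotopy2 L N (p \<bullet> q) (p' \<bullet> q') (HComp2 \<alpha> \<beta>)"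
| Assoc2: "p \<in> RedSeq K L \<Longrightarrow> q \<in> RedSeq L M \<Longrightarrow> r \<in> RedSeq M N \<Longrightarrow>
    is_homotopy2 K N ((p \<bullet> q) \<bullet> r) (p \<bullet> (q \<bullet> r)) (Assoc2 p q r)"
| LeftUnitor2: "p \<in> RedSeq M N \<Longrightarrow> is_homotopy2 M N (Empty M \<bullet> p) p (LeftUnitor2 p)"
| RightUnitor2: "p \<in> RedSeq M N \<Longrightarrow> is_homotopy2 M N (p \<bullet> Empty N) p (RightUnitor2 p)"

definition Homotopy2 :: "trm \<Rightarrow> trm \<Rightarrow> redseq \<Rightarrow> redseq \<Rightarrow> cell2 set" where
  "Homotopy2 M N p q = {\<alpha>. is_homotopy2 M N p q \<alpha>}"

text \<open>The structural generators of 3-cells repeat those of 2-cells one dimension up, with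
  \<^const>\<open>Trans2\<close> in the role of concatenation. The pentagon, triangle and interchange cells relate
  the associators, unitors and compositions of 2-cells.\<close>

datatype cell3 =
    Refl3 cell2
  | Symm3 cell3
  | Trans3 cell3 cell3
  | WhiskerL3 cell2 cell3
  | WhiskerR3 cell3 cell2
  | HComp3 cell3 cell3
  | Assoc3 cell2 cell2 cell2
  | LeftUnitor3 cell2
  | RightUnitor3 cell2
  | Pentagon redseq redseq redseq redseq
  | Triangle redseq redseq
  | Interchange cell2 cell2 cell2 cell2

inductive is_homotopy3 ::
  "trm \<Rightarrow> trm \<Rightarrow> redseq \<Rightarrow> redseq \<Rightarrow> cell2 \<Rightarrow> cell2 \<Rightarrow> cell3 \<Rightarrow> bool" where
  Refl3: "\<alpha> \<in> Homotopy2 M N p q \<Longrightarrow> is_homotopy3 M N p q \<alpha> \<alpha> (Refl3 \<alpha>)"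
| Symm3: "is_homotopy3 M N p q \<alpha> \<beta> \<eta> \<Longrightarrow> is_homotopy3 M N p q \<beta> \<alpha> (Symm3 \<eta>)"
| Trans3: "is_homotopy3 M N p q \<alpha> \<beta> \<eta> \<Longrightarrow> is_homotopy3 M N p q \<beta> \<gamma> \<theta> \<Longrightarrow>
    is_homotopy3 M N p q \<alpha> \<gamma> (Trans3 \<eta> \<theta>)"
| WhiskerL3: "\<gamma> \<in> Homotopy2 M N p q \<Longrightarrow> is_homotopy3 M N q r \<alpha> \<beta> \<eta> \<Longrightarrow>
    is_homotopy3 M N p r (Trans2 \<gamma> \<alpha>) (Trans2 \<gamma> \<beta>) (WhiskerL3 \<gamma> \<eta>)"
| WhiskerR3: "is_homotopy3 M N p q \<alpha> \<beta> \<eta> \<Longrightarrow> \<gamma> \<in> Homotopy2 M N q r \<Longrightarrow>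
    is_homotopy3 M N p r (Trans2 \<alpha> \<gamma>) (Trans2 \<beta> \<gamma>) (WhiskerR3 \<eta> \<gamma>)"
| HComp3: "is_homotopy3 M N p q \<alpha> \<alpha>' \<eta> \<Longrightarrow> is_homotopy3 M N q r \<beta> \<beta>' \<theta> \<Longrightarrow>
    is_homotopy3 M N p r (Trans2 \<alpha> \<beta>) (Trans2 \<alpha>' \<beta>') (HComp3 \<eta> \<theta>)"
| Assoc3: "\<alpha> \<in> Homotopy2 M N p q \<Longrightarrow> \<beta> \<in> Homotopy2 M N q r \<Longrightarrow> \<gamma> \<in> Homotopy2 M N r s \<Longrightarrow>
    is_homotopy3 M N p s
      (Trans2 (Trans2 \<alpha> \<beta>) \<gamma>) (Trans2 \<alpha> (Trans2 \<beta> \<gamma>)) (Assoc3 \<alpha> \<beta> \<gamma>)"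
| LeftUnitor3: "\<alpha> \<in> Homotopy2 M N p q \<Longrightarrow>
    is_homotopy3 M N p q (Trans2 (Refl2 p) \<alpha>) \<alpha> (LeftUnitor3 \<alpha>)"
| RightUnitor3: "\<alpha> \<in> Homotopy2 M N p q \<Longrightarrow>
    is_homotopy3 M N p q (Trans2 \<alpha> (Refl2 q)) \<alpha> (RightUnitor3 \<alpha>)"
| Pentagon: "p \<in> RedSeq J K \<Longrightarrow> q \<in> RedSeq K L \<Longrightarrow> r \<in> RedSeq L M \<Longrightarrow> s \<in> RedSeq M N \<Longrightarrow>
    is_homotopy3 J N (((p \<bullet> q) \<bullet> r) \<bullet> s) (p \<bullet> (q \<bullet> (r \<bullet> s)))
      (Trans2 (Assoc2 (p \<bullet> q) r s) (Assoc2 p q (r \<bullet> s)))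
      (Trans2 (Trans2 (WhiskerR2 (Assoc2 p q r) s) (Assoc2 p (q \<bullet> r) s))
        (WhiskerL2 p (Assoc2 q r s)))
      (Pentagon p q r s)"
| Triangle: "p \<in> RedSeq L M \<Longrightarrow> q \<in> RedSeq M N \<Longrightarrow>
    is_homotopy3 L N ((p \<bullet> Empty M) \<bullet> q) (p \<bullet> q)
      (Trans2 (Assoc2 p (Empty M) q) (WhiskerL2 p (LeftUnitor2 q)))
      (WhiskerR2 (RightUnitor2 p) q)
      (Triangle p q)"
| Interchange: "\<alpha> \<in> Homotopy2 L M p p' \<Longrightarrow> \<alpha>' \<in> Homotopy2 L M p' p'' \<Longrightarrow>
    \<beta> \<in> Homotopy2 M N q q' \<Longrightarrow> \<beta>' \<in> Homotopy2 M N q' q'' \<Longrightarrow>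
    is_homotopy3 L N (p \<bullet> q) (p'' \<bullet> q'')
      (HComp2 (Trans2 \<alpha> \<alpha>') (Trans2 \<beta> \<beta>'))
      (Trans2 (HComp2 \<alpha> \<beta>) (HComp2 \<alpha>' \<beta>'))
      (Interchange \<alpha> \<alpha>' \<beta> \<beta>')"

definition Homotopy3 :: "trm \<Rightarrow> trm \<Rightarrow> redseq \<Rightarrow> redseq \<Rightarrow> cell2 \<Rightarrow> cell2 \<Rightarrow> cell3 set" where
  "Homotopy3 M N p q \<alpha> \<beta> = {\<eta>. is_homotopy3 M N p q \<alpha> \<beta> \<eta>}"

lemma is_redseq_concat:
  "is_redseq L M p \<Longrightarrow> is_redseq M N q \<Longrightarrow> is_redseq L N (p \<bullet> q)"
  by (induction rule: is_redseq.induct) (auto intro: is_redseq.intros)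

lemma RedSeq_Empty: "Empty M \<in> RedSeq M M"
  by (simp add: RedSeq_def is_redseq.Empty)

lemma RedSeq_concat: "p \<in> RedSeq L M \<Longrightarrow> q \<in> RedSeq M N \<Longrightarrow> p \<bullet> q \<in> RedSeq L N"
  by (simp add: RedSeq_def is_redseq_concat)

lemma is_homotopy2_boundary:
  "is_homotopy2 M N p q \<alpha> \<Longrightarrow> p \<in> RedSeq M N \<and> q \<in> RedSeq M N"
  by (induction rule: is_homotopy2.induct) (auto intro: RedSeq_concat RedSeq_Empty)

lemma is_homotopy3_boundary:
  "is_homotopy3 M N p q \<alpha> \<beta> \<eta> \<Longrightarrow> \<alpha> \<in> Homotopy2 M N p q \<and> \<beta> \<in> Homotopy2 M N p q"
proof (induction rule: is_homotopy3.induct)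
  case (Pentagon p J K q L r M s N)
  then have "is_homotopy2 J N (((p \<bullet> q) \<bullet> r) \<bullet> s) ((p \<bullet> q) \<bullet> (r \<bullet> s)) (Assoc2 (p \<bullet> q) r s)"
    "is_homotopy2 J N ((p \<bullet> q) \<bullet> (r \<bullet> s)) (p \<bullet> (q \<bullet> (r \<bullet> s))) (Assoc2 p q (r \<bullet> s))"
    "is_homotopy2 J N (((p \<bullet> q) \<bullet> r) \<bullet> s) ((p \<bullet> (q \<bullet> r)) \<bullet> s) (WhiskerR2 (Assoc2 p q r) s)"
    "is_homotopy2 J N ((p \<bullet> (q \<bullet> r)) \<bullet> s) (p \<bullet> ((q \<bullet> r) \<bullet> s)) (Assoc2 p (q \<bullet> r) s)"
    "is_homotopy2 J N (p \<bullet> ((q \<bullet> r) \<bullet> s)) (p \<bullet> (q \<bullet> (r \<bullet> s))) (WhiskerL2 p (Assoc2 q r s))"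
    by (blast intro: is_homotopy2.intros RedSeq_concat)+
  then show ?case
    unfolding Homotopy2_def by (blast intro: is_homotopy2.Trans2)
next
  case (Triangle p L M q N)
  have "is_homotopy2 L N ((p \<bullet> Empty M) \<bullet> q) (p \<bullet> (Empty M \<bullet> q)) (Assoc2 p (Empty M) q)"
    "is_homotopy2 L N (p \<bullet> (Empty M \<bullet> q)) (p \<bullet> q) (WhiskerL2 p (LeftUnitor2 q))"
    "is_homotopy2 L N ((p \<bullet> Empty M) \<bullet> q) (p \<bullet> q) (WhiskerR2 (RightUnitor2 p) q)"
    using Triangle by (blast intro: is_homotopy2.intros RedSeq_Empty)+
  then show ?case
    unfolding Homotopy2_def by (blast intro: is_homotopy2.Trans2)
qed (auto simp: Homotopy2_def dest: is_homotopy2_boundary intro: is_homotopy2.intros)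


section \<open>Higher derivations\<close>

text \<open>The set \<open>X\<close> plays the role of the ambient type. The action of a map on higher derivations,
  by recursion on constructors, is \<open>map_hderiv\<close>.\<close>

datatype 'a hderiv = HRefl 'a | HSymm "'a hderiv" | HTrans "'a hderiv" "'a hderiv"

inductive is_hderiv :: "'a set \<Rightarrow> 'a \<Rightarrow> 'a \<Rightarrow> 'a hderiv \<Rightarrow> bool" for X where
  HRefl: "x \<in> X \<Longrightarrow> is_hderiv X x x (HRefl x)"
| HSymm: "is_hderiv X x y h \<Longrightarrow> is_hderiv X y x (HSymm h)"
| HTrans: "is_hderiv X x y h \<Longrightarrow> is_hderiv X y z k \<Longrightarrow> is_hderiv X x z (HTrans h k)"

definition HigherDeriv :: "'a set \<Rightarrow> 'a \<Rightarrow> 'a \<Rightarrow> 'a hderiv set" where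
  "HigherDeriv X x y = {h. is_hderiv X x y h}"

lemma is_hderiv_eq: "is_hderiv X x y h \<Longrightarrow> x = y \<and> x \<in> X"
  by (induction rule: is_hderiv.induct) auto

lemma HigherDeriv_eq: "h \<in> HigherDeriv X x y \<Longrightarrow> x = y \<and> x \<in> X"
  unfolding HigherDeriv_def by (drule CollectD, rule is_hderiv_eq)

lemma is_hderiv_map:
  "is_hderiv X x y h \<Longrightarrow> f \<in> X \<rightarrow> Y \<Longrightarrow> is_hderiv Y (f x) (f y) (map_hderiv f h)"
  by (induction rule: is_hderiv.induct) (auto intro: is_hderiv.intros)

lemma map_hderiv_HigherDeriv:
  "f \<in> X \<rightarrow> Y \<Longrightarrow> h \<in> HigherDeriv X x y \<Longrightarrow>
    map_hderiv f h \<in> HigherDeriv Y (f x) (f y)"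
  by (simp add: HigherDeriv_def is_hderiv_map)


section \<open>Globular sets\<close>

text \<open>All cells of a globular set live in one HOL type; \<open>C n\<close> is the set of \<open>n\<close>-cells. The source
  and target functions matter only on cells of positive dimension; on 0-cells they are given the
  junk value \<open>s x = t x = x\<close> below.\<close>

definition globular_set :: "(nat \<Rightarrow> 'a set) \<Rightarrow> ('a \<Rightarrow> 'a) \<Rightarrow> ('a \<Rightarrow> 'a) \<Rightarrow> bool" where
  "globular_set C s t \<longleftrightarrow>
    (\<forall>n. s \<in> C (Suc n) \<rightarrow> C n \<and> t \<in> C (Suc n) \<rightarrow> C n) \<and>
    (\<forall>n. \<forall>x\<in>C (Suc (Suc n)). s (s x) = s (t x) \<and> t (s x) = t (t x))"


section \<open>The low-dimensional core\<close>

datatype core =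
    Cell0 trm
  | Cell1 trm trm redseq
  | Cell2 trm trm redseq redseq cell2
  | Cell3 trm trm redseq redseq cell2 cell2 cell3

primrec core_src :: "core \<Rightarrow> core" where
  "core_src (Cell0 M) = Cell0 M"
| "core_src (Cell1 M N p) = Cell0 M"
| "core_src (Cell2 M N p q \<alpha>) = Cell1 M N p"
| "core_src (Cell3 M N p q \<alpha> \<beta> \<eta>) = Cell2 M N p q \<alpha>"

primrec core_tgt :: "core \<Rightarrow> core" where
  "core_tgt (Cell0 M) = Cell0 M"
| "core_tgt (Cell1 M N p) = Cell0 N"
| "core_tgt (Cell2 M N p q \<alpha>) = Cell1 M N q"
| "core_tgt (Cell3 M N p q \<alpha> \<beta> \<eta>) = Cell2 M N p q \<beta>"

definition G_core :: "nat \<Rightarrow> core set" where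
  "G_core n =
    (if n = 0 then {Cell0 M | M. True}
     else if n = 1 then {Cell1 M N p | M N p. p \<in> RedSeq M N}
     else if n = 2 then {Cell2 M N p q \<alpha> | M N p q \<alpha>.
       p \<in> RedSeq M N \<and> q \<in> RedSeq M N \<and> \<alpha> \<in> Homotopy2 M N p q}
     else if n = 3 then {Cell3 M N p q \<alpha> \<beta> \<eta> | M N p q \<alpha> \<beta> \<eta>.
       p \<in> RedSeq M N \<and> q \<in> RedSeq M N \<and>
       \<alpha> \<in> Homotopy2 M N p q \<and> \<beta> \<in> Homotopy2 M N p q \<and> \<eta> \<in> Homotopy3 M N p q \<alpha> \<beta>}
     else {})"


section \<open>Towers of higher derivations over given low-dimensional cells\<close>

datatype 'a tower = Base 'a | Deriv "'a tower" "'a tower" "'a tower hderiv"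

primrec tower_src :: "('a \<Rightarrow> 'a) \<Rightarrow> 'a tower \<Rightarrow> 'a tower" where
  "tower_src s (Base c) = Base (s c)"
| "tower_src s (Deriv x y h) = x"

primrec tower_tgt :: "('a \<Rightarrow> 'a) \<Rightarrow> 'a tower \<Rightarrow> 'a tower" where
  "tower_tgt t (Base c) = Base (t c)"
| "tower_tgt t (Deriv x y h) = y"


section \<open>The explicit tower\<close>

abbreviation Sigma_src :: "core tower \<Rightarrow> core tower" where
  "Sigma_src \<equiv> tower_src core_src"

abbreviation Sigma_tgt :: "core tower \<Rightarrow> core tower" where
  "Sigma_tgt \<equiv> tower_tgt core_tgt"

fun Sigma_cells :: "nat \<Rightarrow> core tower set" where
  "Sigma_cells 0 = Base ` G_core 0"
| "Sigma_cells (Suc n) =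
    (if Suc n \<le> 3 then Base ` G_core (Suc n)
     else {Deriv x y h | x y h. x \<in> Sigma_cells n \<and> y \<in> Sigma_cells n \<and>
       Sigma_src x = Sigma_src y \<and> Sigma_tgt x = Sigma_tgt y \<and>
       h \<in> HigherDeriv (Sigma_cells n) x y})"


section \<open>The reflexive 6-cell extension of the core\<close>

text \<open>Unlike in the explicit tower, the derivations in dimensions 4, 5, 6 are taken over the family
  of cells with a fixed boundary: a 4-cell lies in \<open>HigherDeriv X \<eta> \<theta>\<close> with \<open>X\<close> the 3-cells from
  \<open>\<alpha>\<close> to \<open>\<beta>\<close>, a 5-cell is a derivation over the 4-cells from \<open>\<eta>\<close> to \<open>\<theta>\<close>, and so on.\<close>

type_synonym cell4 = "cell3 hderiv"
type_synonym cell5 = "cell4 hderiv"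
type_synonym cell6 = "cell5 hderiv"

definition Deriv4 ::
  "trm \<Rightarrow> trm \<Rightarrow> redseq \<Rightarrow> redseq \<Rightarrow> cell2 \<Rightarrow> cell2 \<Rightarrow> cell3 \<Rightarrow> cell3 \<Rightarrow> cell4 set" where
  "Deriv4 M N p q \<alpha> \<beta> \<eta> \<theta> = HigherDeriv (Homotopy3 M N p q \<alpha> \<beta>) \<eta> \<theta>"

definition Deriv5 ::
  "trm \<Rightarrow> trm \<Rightarrow> redseq \<Rightarrow> redseq \<Rightarrow> cell2 \<Rightarrow> cell2 \<Rightarrow> cell3 \<Rightarrow> cell3 \<Rightarrow> cell4 \<Rightarrow> cell4 \<Rightarrow> cell5 set"
where
  "Deriv5 M N p q \<alpha> \<beta> \<eta> \<theta> h k = HigherDeriv (Deriv4 M N p q \<alpha> \<beta> \<eta> \<theta>) h k"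

definition Deriv6 ::
  "trm \<Rightarrow> trm \<Rightarrow> redseq \<Rightarrow> redseq \<Rightarrow> cell2 \<Rightarrow> cell2 \<Rightarrow> cell3 \<Rightarrow> cell3 \<Rightarrow> cell4 \<Rightarrow> cell4 \<Rightarrow>
    cell5 \<Rightarrow> cell5 \<Rightarrow> cell6 set"
where
  "Deriv6 M N p q \<alpha> \<beta> \<eta> \<theta> h k u v = HigherDeriv (Deriv5 M N p q \<alpha> \<beta> \<eta> \<theta> h k) u v"

datatype ext =
    Core core
  | Cell4 trm trm redseq redseq cell2 cell2 cell3 cell3 cell4
  | Cell5 trm trm redseq redseq cell2 cell2 cell3 cell3 cell4 cell4 cell5
  | Cell6 trm trm redseq redseq cell2 cell2 cell3 cell3 cell4 cell4 cell5 cell5 cell6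

primrec ext_src :: "ext \<Rightarrow> ext" where
  "ext_src (Core c) = Core (core_src c)"
| "ext_src (Cell4 M N p q \<alpha> \<beta> \<eta> \<theta> h) = Core (Cell3 M N p q \<alpha> \<beta> \<eta>)"
| "ext_src (Cell5 M N p q \<alpha> \<beta> \<eta> \<theta> h k u) = Cell4 M N p q \<alpha> \<beta> \<eta> \<theta> h"
| "ext_src (Cell6 M N p q \<alpha> \<beta> \<eta> \<theta> h k u v w) = Cell5 M N p q \<alpha> \<beta> \<eta> \<theta> h k u"

primrec ext_tgt :: "ext \<Rightarrow> ext" where
  "ext_tgt (Core c) = Core (core_tgt c)"
| "ext_tgt (Cell4 M N p q \<alpha> \<beta> \<eta> \<theta> h) = Core (Cell3 M N p q \<alpha> \<beta> \<theta>)"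
| "ext_tgt (Cell5 M N p q \<alpha> \<beta> \<eta> \<theta> h k u) = Cell4 M N p q \<alpha> \<beta> \<eta> \<theta> k"
| "ext_tgt (Cell6 M N p q \<alpha> \<beta> \<eta> \<theta> h k u v w) = Cell5 M N p q \<alpha> \<beta> \<eta> \<theta> h k v"

definition G_ext :: "nat \<Rightarrow> ext set" where
  "G_ext n =
    (if n \<le> 3 then Core ` G_core n
     else if n = 4 then {Cell4 M N p q \<alpha> \<beta> \<eta> \<theta> h | M N p q \<alpha> \<beta> \<eta> \<theta> h.
       Cell3 M N p q \<alpha> \<beta> \<eta> \<in> G_core 3 \<and> Cell3 M N p q \<alpha> \<beta> \<theta> \<in> G_core 3 \<and>
       h \<in> Deriv4 M N p q \<alpha> \<beta> \<eta> \<theta>}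
     else if n = 5 then {Cell5 M N p q \<alpha> \<beta> \<eta> \<theta> h k u | M N p q \<alpha> \<beta> \<eta> \<theta> h k u.
       Cell3 M N p q \<alpha> \<beta> \<eta> \<in> G_core 3 \<and> Cell3 M N p q \<alpha> \<beta> \<theta> \<in> G_core 3 \<and>
       h \<in> Deriv4 M N p q \<alpha> \<beta> \<eta> \<theta> \<and> k \<in> Deriv4 M N p q \<alpha> \<beta> \<eta> \<theta> \<and>
       u \<in> Deriv5 M N p q \<alpha> \<beta> \<eta> \<theta> h k}
     else if n = 6 then {Cell6 M N p q \<alpha> \<beta> \<eta> \<theta> h k u v w | M N p q \<alpha> \<beta> \<eta> \<theta> h k u v w.
       Cell3 M N p q \<alpha> \<beta> \<eta> \<in> G_core 3 \<and> Cell3 M N p q \<alpha> \<beta> \<theta> \<in> G_core 3 \<and>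
       h \<in> Deriv4 M N p q \<alpha> \<beta> \<eta> \<theta> \<and> k \<in> Deriv4 M N p q \<alpha> \<beta> \<eta> \<theta> \<and>
       u \<in> Deriv5 M N p q \<alpha> \<beta> \<eta> \<theta> h k \<and> v \<in> Deriv5 M N p q \<alpha> \<beta> \<eta> \<theta> h k \<and>
       w \<in> Deriv6 M N p q \<alpha> \<beta> \<eta> \<theta> h k u v}
     else {})"


section \<open>The recursive completion\<close>

abbreviation R_src :: "ext tower \<Rightarrow> ext tower" where
  "R_src \<equiv> tower_src ext_src"

abbreviation R_tgt :: "ext tower \<Rightarrow> ext tower" where
  "R_tgt \<equiv> tower_tgt ext_tgt"

text \<open>No parallelism of \<open>x\<close> and \<open>y\<close> is required here, in contrast to the explicit tower.\<close>

fun R_cells :: "nat \<Rightarrow> ext tower set" where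
  "R_cells 0 = Base ` G_ext 0"
| "R_cells (Suc n) =
    (if Suc n \<le> 6 then Base ` G_ext (Suc n)
     else {Deriv x y h | x y h. x \<in> R_cells n \<and> y \<in> R_cells n \<and>
       h \<in> HigherDeriv (R_cells n) x y})"

section \<open>Both towers are globular sets\<close>

lemma globular_set_core: "globular_set G_core core_src core_tgt"
  by (auto simp: globular_set_def G_core_def)

lemma globular_set_ext: "globular_set G_ext ext_src ext_tgt"
proof -
  have core_cells: "core_src c \<in> G_core n" "core_tgt c \<in> G_core n" if "c \<in> G_core (Suc n)" for c n
    using globular_set_core that by (auto simp: globular_set_def)
  have core_glob: "core_src (core_src c) = core_src (core_tgt c)"
    "core_tgt (core_src c) = core_tgt (core_tgt c)" if "c \<in> G_core (Suc (Suc n))" for c n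
    using globular_set_core that by (auto simp: globular_set_def)
  have high: "x \<in> G_ext n \<longleftrightarrow> False" if "n > 6" for x n
    using that by (simp add: G_ext_def)
  have step: "ext_src x \<in> G_ext n \<and> ext_tgt x \<in> G_ext n" if x: "x \<in> G_ext (Suc n)" for x n
  proof -
    consider "n < 3" | "n = 3" | "n = 4" | "n = 5" | "n > 5" by linarith
    then show ?thesis
    proof cases
      case 1
      with x obtain c where "c \<in> G_core (Suc n)" "x = Core c" by (auto simp: G_ext_def)
      with 1 core_cells[of c n] show ?thesis by (auto simp: G_ext_def)
    qed (use x high[of "Suc n" x] in \<open>auto simp: G_ext_def\<close>)
  qed
  have glob: "ext_src (ext_src x) = ext_src (ext_tgt x) \<and> ext_tgt (ext_src x) = ext_tgt (ext_tgt x)"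
    if x: "x \<in> G_ext (Suc (Suc n))" for x n
  proof -
    consider "n < 2" | "n = 2" | "n = 3" | "n = 4" | "n > 4" by linarith
    then show ?thesis
    proof cases
      case 1
      with x obtain c where "c \<in> G_core (Suc (Suc n))" "x = Core c" by (auto simp: G_ext_def)
      with core_glob[of c n] show ?thesis by auto
    qed (use x high[of "Suc (Suc n)" x] in \<open>auto simp: G_ext_def\<close>)
  qed
  show ?thesis
    using step glob by (auto simp: globular_set_def)
qed

lemma globular_set_Sigma: "globular_set Sigma_cells Sigma_src Sigma_tgt"
proof -
  have base: "Sigma_cells n = Base ` G_core n" if "n \<le> 3" for n
    using that by (cases n) auto
  have step: "Sigma_src x \<in> Sigma_cells n \<and> Sigma_tgt x \<in> Sigma_cells n"
    if x: "x \<in> Sigma_cells (Suc n)" for x n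
  proof (cases "Suc n \<le> 3")
    case True
    with x obtain c where "c \<in> G_core (Suc n)" "x = Base c" by auto
    with True globular_set_core show ?thesis
      by (auto simp: base globular_set_def)
  qed (use x in auto)
  have glob: "Sigma_src (Sigma_src x) = Sigma_src (Sigma_tgt x) \<and>
      Sigma_tgt (Sigma_src x) = Sigma_tgt (Sigma_tgt x)"
    if x: "x \<in> Sigma_cells (Suc (Suc n))" for x n
  proof (cases "Suc (Suc n) \<le> 3")
    case True
    with x obtain c where "c \<in> G_core (Suc (Suc n))" "x = Base c" by auto
    with globular_set_core show ?thesis
      by (auto simp: globular_set_def)
  next
    case False
    then have "Sigma_cells (Suc (Suc n)) = {Deriv y z h | y z h.
        y \<in> Sigma_cells (Suc n) \<and> z \<in> Sigma_cells (Suc n) \<and>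
        Sigma_src y = Sigma_src z \<and> Sigma_tgt y = Sigma_tgt z \<and>
        h \<in> HigherDeriv (Sigma_cells (Suc n)) y z}"
      by (subst Sigma_cells.simps(2)) (simp only: if_False)
    with x show ?thesis by auto
  qed
  show ?thesis
    using step glob by (auto simp: globular_set_def)
qed

lemma globular_set_R: "globular_set R_cells R_src R_tgt"
proof -
  have base: "R_cells n = Base ` G_ext n" if "n \<le> 6" for n
    using that by (cases n) auto
  have step: "R_src x \<in> R_cells n \<and> R_tgt x \<in> R_cells n" if x: "x \<in> R_cells (Suc n)" for x n
  proof (cases "Suc n \<le> 6")
    case True
    with x obtain c where "c \<in> G_ext (Suc n)" "x = Base c" by auto
    with True globular_set_ext show ?thesis
      by (auto simp: base globular_set_def)
  qed (use x in auto)
  have glob: "R_src (R_src x) = R_src (R_tgt x) \<and> R_tgt (R_src x) = R_tgt (R_tgt x)"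
    if x: "x \<in> R_cells (Suc (Suc n))" for x n
  proof (cases "Suc (Suc n) \<le> 6")
    case True
    with x obtain c where "c \<in> G_ext (Suc (Suc n))" "x = Base c" by auto
    with globular_set_ext show ?thesis
      by (auto simp: globular_set_def)
  next
    case False
    then have "R_cells (Suc (Suc n)) = {Deriv y z h | y z h.
        y \<in> R_cells (Suc n) \<and> z \<in> R_cells (Suc n) \<and> h \<in> HigherDeriv (R_cells (Suc n)) y z}"
      by (subst R_cells.simps(2)) (simp only: if_False)
    with x show ?thesis by (auto dest: HigherDeriv_eq)
  qed
  show ?thesis
    using step glob by (auto simp: globular_set_def)
qed

end

theory Submission imports Defs begin

text \<open>A derivation over the cells with a fixed boundary is carried to a derivation over all cells of
  that dimension by mapping along the realization of those cells. The explicit tower asks for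
  parallel boundaries while the completion does not; this is harmless, since a derivation exists
  only between equal cells.\<close>

abbreviation real3 where
  "real3 M N p q \<alpha> \<beta> \<eta> \<equiv> Base (Cell3 M N p q \<alpha> \<beta> \<eta>)"

text \<open>The boundary arguments come first, so that the partial application fixing them is a map
  on one family of parallel cells, which \<open>map_hderiv\<close> can take one dimension
  up.\<close>

definition real4 where
  "real4 M N p q \<alpha> \<beta> \<eta> \<theta> h =
    Deriv (real3 M N p q \<alpha> \<beta> \<eta>) (real3 M N p q \<alpha> \<beta> \<theta>) (map_hderiv (real3 M N p q \<alpha> \<beta>) h)"

definition real5 where
  "real5 M N p q \<alpha> \<beta> \<eta> \<theta> h k u =
    Deriv (real4 M N p q \<alpha> \<beta> \<eta> \<theta> h) (real4 M N p q \<alpha> \<beta> \<eta> \<theta> k)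
      (map_hderiv (real4 M N p q \<alpha> \<beta> \<eta> \<theta>) u)"

definition real6 where
  "real6 M N p q \<alpha> \<beta> \<eta> \<theta> h k u v w =
    Deriv (real5 M N p q \<alpha> \<beta> \<eta> \<theta> h k u) (real5 M N p q \<alpha> \<beta> \<eta> \<theta> h k v)
      (map_hderiv (real5 M N p q \<alpha> \<beta> \<eta> \<theta> h k) w)"

primrec real_ext :: "ext \<Rightarrow> core tower" where
  "real_ext (Core c) = Base c"
| "real_ext (Cell4 M N p q \<alpha> \<beta> \<eta> \<theta> h) = real4 M N p q \<alpha> \<beta> \<eta> \<theta> h"
| "real_ext (Cell5 M N p q \<alpha> \<beta> \<eta> \<theta> h k u) = real5 M N p q \<alpha> \<beta> \<eta> \<theta> h k u"
| "real_ext (Cell6 M N p q \<alpha> \<beta> \<eta> \<theta> h k u v w) = real6 M N p q \<alpha> \<beta> \<eta> \<theta> h k u v w"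

text \<open>The constructor of a cell already determines its realization, so one map without a
  dimension index serves every \<open>n\<close>. The recursion reaches the cells inside
  \<open>h\<close> through \<open>map_hderiv\<close>.\<close>

primrec real_tower :: "ext tower \<Rightarrow> core tower" where
  "real_tower (Base e) = real_ext e"
| "real_tower (Deriv x y h) = Deriv (real_tower x) (real_tower y) (map_hderiv real_tower h)"

text \<open>True of all raw cells, well formed or not: a realized derivation stores the realizations
  of its two boundary cells, and on \<open>Core\<close> both sides apply \<open>core_src\<close>, so
  even the junk values at 0-cells agree.\<close>

lemma Sigma_src_real_ext: "Sigma_src (real_ext e) = real_ext (ext_src e)"
  by (cases e) (simp_all add: real4_def real5_def real6_def)

lemma Sigma_tgt_real_ext: "Sigma_tgt (real_ext e) = real_ext (ext_tgt e)"
  by (cases e) (simp_all add: real4_def real5_def real6_def)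

lemma Sigma_src_real_tower: "Sigma_src (real_tower x) = real_tower (R_src x)"
  by (cases x) (simp_all add: Sigma_src_real_ext)

lemma Sigma_tgt_real_tower: "Sigma_tgt (real_tower x) = real_tower (R_tgt x)"
  by (cases x) (simp_all add: Sigma_tgt_real_ext)

lemma Sigma_cells_low: "n \<le> 3 \<Longrightarrow> Sigma_cells n = Base ` G_core n"
  by (cases n) auto

lemma R_cells_low: "n \<le> 6 \<Longrightarrow> R_cells n = Base ` G_ext n"
  by (cases n) auto

text \<open>A derivation forces \<open>x = y\<close> with \<open>x\<close> an \<open>n\<close>-cell,
  so parallelism is automatic; \<open>3 \<le> n\<close> selects the derivation clause at
  \<open>Suc n\<close>.\<close>

lemma Deriv_in_Sigma_cells:
  assumes "3 \<le> n" "h \<in> HigherDeriv (Sigma_cells n) x y"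
  shows "Deriv x y h \<in> Sigma_cells (Suc n)"
  using assms HigherDeriv_eq[OF assms(2)] by auto

lemma map_Deriv_in_Sigma_cells:
  assumes "3 \<le> n" "f \<in> X \<rightarrow> Sigma_cells n" "h \<in> HigherDeriv X x y"
  shows "Deriv (f x) (f y) (map_hderiv f h) \<in> Sigma_cells (Suc n)"
  using assms by (intro Deriv_in_Sigma_cells map_hderiv_HigherDeriv)

text \<open>\<open>G_core 3\<close> also asks for well-formed 1-cells and 2-cells in the boundary;
  these are recovered from \<open>\<eta>\<close> by the boundary lemmas.\<close>

lemma real3_in: "real3 M N p q \<alpha> \<beta> \<in> Homotopy3 M N p q \<alpha> \<beta> \<rightarrow> Sigma_cells 3"
proof
  fix \<eta> assume \<eta>: "\<eta> \<in> Homotopy3 M N p q \<alpha> \<beta>"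
  then have "\<alpha> \<in> Homotopy2 M N p q" "\<beta> \<in> Homotopy2 M N p q"
    by (auto simp: Homotopy3_def dest: is_homotopy3_boundary)
  moreover from this have "p \<in> RedSeq M N" "q \<in> RedSeq M N"
    by (auto simp: Homotopy2_def dest: is_homotopy2_boundary)
  ultimately show "real3 M N p q \<alpha> \<beta> \<eta> \<in> Sigma_cells 3"
    using \<eta> by (simp add: Sigma_cells_low G_core_def image_iff)
qed

text \<open>First link of a chain up to dimension 6: each membership result supplies the map
  \<open>f\<close> for the next dimension.\<close>

lemma real4_in: "real4 M N p q \<alpha> \<beta> \<eta> \<theta> \<in> Deriv4 M N p q \<alpha> \<beta> \<eta> \<theta> \<rightarrow> Sigma_cells 4"
  using map_Deriv_in_Sigma_cells[OF _ real3_in] by (auto simp: real4_def Deriv4_def)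

lemma real5_in: "real5 M N p q \<alpha> \<beta> \<eta> \<theta> h k \<in> Deriv5 M N p q \<alpha> \<beta> \<eta> \<theta> h k \<rightarrow> Sigma_cells 5"
  using map_Deriv_in_Sigma_cells[OF _ real4_in] by (auto simp: real5_def Deriv5_def)

lemma real6_in:
  "real6 M N p q \<alpha> \<beta> \<eta> \<theta> h k u v \<in> Deriv6 M N p q \<alpha> \<beta> \<eta> \<theta> h k u v \<rightarrow> Sigma_cells 6"
  using map_Deriv_in_Sigma_cells[OF _ real5_in] by (auto simp: real6_def Deriv6_def)

lemma real_ext_in:
  assumes "n \<le> 6"
  shows "real_ext \<in> G_ext n \<rightarrow> Sigma_cells n"
proof -
  consider "n \<le> 3" | "n = 4" | "n = 5" | "n = 6" using assms by linarith
  then show ?thesis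
  proof cases
    case 1
    then show ?thesis by (auto simp: G_ext_def Sigma_cells_low)
  next
    case 2
    then show ?thesis using funcset_mem[OF real4_in] by (auto simp: G_ext_def)
  next
    case 3
    then show ?thesis using funcset_mem[OF real5_in] by (auto simp: G_ext_def)
  next
    case 4
    then show ?thesis using funcset_mem[OF real6_in] by (auto simp: G_ext_def)
  qed
qed

lemma real_tower_in: "real_tower \<in> R_cells n \<rightarrow> Sigma_cells n"
proof (induction n)
  case 0
  then show ?case
    using real_ext_in[of 0] by (auto simp del: Sigma_cells.simps)
next
  case (Suc n)
  show ?case
  proof (cases "Suc n \<le> 6")
    case True
    then show ?thesis using real_ext_in[OF True] by (auto simp only: R_cells_low real_tower.simps)
  next
    case False
    then have "R_cells (Suc n) = {Deriv x y h | x y h. x \<in> R_cells n \<and> y \<in> R_cells n \<and>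
        h \<in> HigherDeriv (R_cells n) x y}"
      by simp
    moreover have "3 \<le> n" using False by simp
    \<comment> \<open>The induction hypothesis is itself the assumption on \<open>f\<close>, with
      \<open>X = R_cells n\<close> and \<open>f = real_tower\<close>.\<close>
    ultimately show ?thesis
      using map_Deriv_in_Sigma_cells[OF _ Suc.IH] by (auto simp del: Sigma_cells.simps)
  qed
qed

theorem theoremA:
  "\<exists>realize :: nat \<Rightarrow> ext tower \<Rightarrow> core tower.
     (\<forall>n. realize n \<in> R_cells n \<rightarrow> Sigma_cells n) \<and>
     (\<forall>n. \<forall>x\<in>R_cells (Suc n).
        Sigma_src (realize (Suc n) x) = realize n (R_src x) \<and>
        Sigma_tgt (realize (Suc n) x) = realize n (R_tgt x)) \<and>
     (\<forall>n\<le>3. \<forall>c\<in>G_core n. realize n (Base (Core c)) = Base c)"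
  \<comment> \<open>The witness is constant in \<open>n\<close>; on the core,
    \<open>real_tower (Base (Core c))\<close> computes to \<open>Base c\<close>.\<close>
  by (rule exI[of _ "\<lambda>n. real_tower"])
    (simp add: real_tower_in Sigma_src_real_tower Sigma_tgt_real_tower
      del: R_cells.simps Sigma_cells.simps)

end
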